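(* Let $\Omega \subset \mathbb{C}$ be a simply connected domain. There exists an unbounded analytic function $f:\Omega\to\mathbb{C}$ whose first derivative $f'$ is bounded on $\Omega$ if and only if $\Omega$ has infinite diameter in its interior path metric $d_\Omega$, i.e. $\sup_{p,q\in\Omega} d_\Omega(p,q)=\infty$.
   Context: A domain is a nonempty connected open subset of $\mathbb{C}$. For a domain $\Omega\subset\mathbb{C}$ and $p,q\in\Omega$, the interior path metric $d_\Omega(p,q)$ is the infimum of the (Euclidean) lengths of rectifiable curves lying entirely in $\Omega$ and joining $p$ to $q$. *)

theory Defs
  imports "HOL-Analysis.Analysis"
begin

definition domain :: "complex set \<Rightarrow> bool" where
  "domain \<Omega> \<longleftrightarrow> \<Omega> \<noteq> {} \<and> open \<Omega> \<and> connected \<Omega>"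

(* Supremum of the lengths of inscribed polygons over all partitions
   0 = t 0 <= t 1 <= ... <= t n = 1; the value is infinity for non-rectifiable curves. *)
definition curve_length :: "(real \<Rightarrow> 'a::metric_space) \<Rightarrow> ennreal" where
  "curve_length g =
     (SUP (n, t) \<in> {(n :: nat, t :: nat \<Rightarrow> real). t 0 = 0 \<and> t n = 1 \<and> mono_on {..n} t}.
        \<Sum>i<n. ennreal (dist (g (t i)) (g (t (Suc i)))))"

definition rectifiable :: "(real \<Rightarrow> 'a::metric_space) \<Rightarrow> bool" where
  "rectifiable g \<longleftrightarrow> path g \<and> curve_length g < \<infinity>"

(* Valued in ennreal so that its supremum may be infinite. For p, q in a domain the
   set of curves is nonempty, hence the value is then finite. *)
definition interior_path_metric :: "complex set \<Rightarrow> complex \<Rightarrow> complex \<Rightarrow> ennreal" where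
  "interior_path_metric \<Omega> p q =
     (INF g \<in> {g. rectifiable g \<and> path_image g \<subseteq> \<Omega> \<and> pathstart g = p \<and> pathfinish g = q}.
        curve_length g)"

end

theory Submission
  imports Defs "HOL-Complex_Analysis.Complex_Analysis"
begin

text \<open>A function with derivative bounded by \<open>B\<close> is \<open>B\<close>-Lipschitz for the interior path metric, which
  gives one direction. For the other, let \<open>\<Psi>\<close> map the strip \<open>\<bar>Im \<zeta>\<bar> < \<pi>/2\<close> conformally onto
  \<open>\<Omega> \<noteq> \<complex>\<close>, with two given points of \<open>\<Omega>\<close> on the image of the real axis, and write
  \<open>\<Psi>' = exp g\<close>. Since \<open>\<Psi>\<close> is injective on every unit disc centred on the real axis, distortion
  bounds \<open>g'\<close> there by an absolute constant, so the phase \<open>exp (- \<i> Im g)\<close> varies slowly, and its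
  Gaussian convolution \<open>h\<close> is bounded on the strip with \<open>Re (h exp g) \<ge> c \<bar>exp g\<bar>\<close> on the real axis.
  A primitive \<open>f\<close> of \<open>h \<circ> \<Psi>\<^sup>-\<^sup>1\<close> then has \<open>\<bar>f'\<bar>\<close> bounded by an absolute constant, while its increment
  between the two points is at least \<open>c\<close> times the length of the image curve, hence at least \<open>c\<close> times
  their interior distance. A gliding hump combines such functions into an unbounded one.\<close>

section \<open>Distortion of injective holomorphic functions on unit discs\<close>

text \<open>If the image contained the closed disc of radius \<open>R = 2 * cmod (deriv f a)\<close>
  about \<open>f a\<close>, the inverse would map that disc into the unit disc about
  \<open>a\<close>. Cauchy's estimate would then bound the derivative of the inverse at
  \<open>f a\<close> by \<open>1 / R\<close>, half of its actual modulus
  \<open>1 / cmod (deriv f a)\<close>.\<close>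

lemma injective_holomorphic_omits_near_value:
  assumes holf: "f holomorphic_on ball a 1" and inj: "inj_on f (ball a 1)"
  obtains w where "w \<notin> f ` ball a 1" "cmod (w - f a) \<le> 2 * cmod (deriv f a)"
proof -
  have f'0: "deriv f a \<noteq> 0"
    using holomorphic_injective_imp_regular[OF holf open_ball inj] by simp
  define R where "R = 2 * cmod (deriv f a)"
  have R: "R > 0" using f'0 by (simp add: R_def)
  obtain g where holg: "g holomorphic_on f ` ball a 1"
    and g': "\<And>z. z \<in> ball a 1 \<Longrightarrow> deriv f z * deriv g (f z) = 1"
    and g: "\<And>z. z \<in> ball a 1 \<Longrightarrow> g (f z) = z"
    using holomorphic_has_inverse[OF holf open_ball inj] by blast
  have "\<not> cball (f a) R \<subseteq> f ` ball a 1"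
  proof
    assume sub: "cball (f a) R \<subseteq> f ` ball a 1"
    have "cmod ((deriv ^^ 1) g (f a)) \<le> fact 1 * 1 / R ^ 1"
    proof (rule Cauchy_higher_deriv_bound[where y = a])
      have "g holomorphic_on cball (f a) R"
        using holg sub by (rule holomorphic_on_subset)
      then show "g holomorphic_on ball (f a) R" "continuous_on (cball (f a) R) g"
        by (auto intro: holomorphic_on_subset holomorphic_on_imp_continuous_on)
      show "g w \<in> ball a 1" if "w \<in> ball (f a) R" for w
      proof -
        have "w \<in> f ` ball a 1" using that sub by auto
        then show ?thesis using g by auto
      qed
    qed (use R in auto)
    then have "cmod (deriv f a) * cmod (deriv g (f a)) \<le> cmod (deriv f a) * (1 / R)"
      by (intro mult_left_mono) auto
    then show False
      using g'[of a] f'0 by (simp add: R_def flip: norm_mult)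
  qed
  then obtain w where "w \<in> cball (f a) R" "w \<notin> f ` ball a 1" by blast
  then show thesis
    by (intro that[of w]) (auto simp: R_def dist_norm norm_minus_commute)
qed

text \<open>If \<open>w\<close> is an omitted value, a branch of the square root of \<open>(w - f) / (w - f a)\<close> with
  value \<open>1\<close> at \<open>a\<close> omits \<open>0\<close>, and by injectivity of \<open>f\<close> also \<open>-1\<close>; so Schottky's theorem
  bounds it.\<close>

lemma injective_holomorphic_second_deriv_bound:
  obtains C :: real where "C \<ge> 1"
    "\<And>f a. f holomorphic_on ball a 1 \<Longrightarrow> inj_on f (ball a 1) \<Longrightarrow>
       cmod (deriv (deriv f) a) \<le> C * cmod (deriv f a)"
proof -
  \<comment> \<open>Schottky's bound on the disc of radius 1/2, for functions of modulus at most 1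
    at the origin. \<open>C\<close> is what Cauchy's estimate for the second derivative on radius
    1/4 makes of it.\<close>
  define K where "K = exp (pi * exp (pi * (2 + 2 * 1 + 12 * (1/2) / (1 - 1/2))))"
  define C where "C = 128 + 64 * K\<^sup>2"
  have bound: "cmod (deriv (deriv f) a) \<le> C * cmod (deriv f a)"
    if holf: "f holomorphic_on ball a 1" and inj: "inj_on f (ball a 1)" for f a
  proof -
    have f'0: "deriv f a \<noteq> 0"
      using holomorphic_injective_imp_regular[OF holf open_ball inj] by simp
    obtain w where w: "w \<notin> f ` ball a 1" and wle: "cmod (w - f a) \<le> 2 * cmod (deriv f a)"
      using injective_holomorphic_omits_near_value[OF holf inj] .
    have wa: "w - f a \<noteq> 0" using w by auto
    have "(\<lambda>z. (w - f z) / (w - f a)) holomorphic_on ball a 1"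
      using wa by (intro holomorphic_intros holf) auto
    moreover have "\<forall>z \<in> ball a 1. (w - f z) / (w - f a) \<noteq> 0"
      using w wa by auto
    moreover have "simply_connected (ball a (1::real))"
      by (simp add: convex_imp_simply_connected)
    ultimately obtain s where hols: "s holomorphic_on ball a 1"
      and s: "\<And>z. z \<in> ball a 1 \<Longrightarrow> (w - f z) / (w - f a) = (s z)\<^sup>2"
      using iffD1[OF simply_connected_eq_holomorphic_sqrt[OF open_ball, of a 1]] by blast
    have sa: "(s a)\<^sup>2 = 1" using s[of a] wa by simp
    \<comment> \<open>The branch is normalised by \<open>s a\<close>, which is 1 or -1. The minus
      sign turns the omitted value -1 into 1, and halving the argument makes \<open>F\<close>
      holomorphic on the closed unit disc, as Schottky's theorem requires.\<close>
    define F where "F = (\<lambda>z. - s (a + z / 2) / s a)"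
    have sa0: "s a \<noteq> 0" using sa by auto
    have F2: "(w - f (a + z / 2)) / (w - f a) = (F z)\<^sup>2" if "z \<in> cball 0 1" for z
      using s[of "a + z / 2"] that sa by (simp add: F_def power_divide dist_norm norm_divide)
    have holF: "F holomorphic_on cball 0 1"
      unfolding F_def using sa0
      by (intro holomorphic_intros holomorphic_on_compose_gen[OF _ hols, unfolded o_def])
         (auto simp: dist_norm norm_divide)
    have F01: "\<not> (F z = 0 \<or> F z = 1)" if z: "z \<in> cball 0 1" for z
    proof -
      have zb: "a + z / 2 \<in> ball a 1" using z by (simp add: dist_norm norm_divide)
      have "F z \<noteq> 0" using F2[OF z] w zb wa by auto
      \<comment> \<open>Squaring \<open>F z = 1\<close> gives \<open>f (a + z / 2) = f a\<close>, so
        \<open>z = 0\<close> by injectivity; but \<open>F 0 = - 1\<close>.\<close>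
      moreover have "F z \<noteq> 1"
      proof
        assume F1: "F z = 1"
        then have "f (a + z / 2) = f a" using F2[OF z] wa by auto
        then have "z = 0" using inj_onD[OF inj _ zb, of a] by simp
        then show False using F1 sa0 by (simp add: F_def)
      qed
      ultimately show ?thesis by simp
    qed
    have FK: "cmod (F z) \<le> K" if "cmod z \<le> 1/2" for z
      unfolding K_def by (rule Schottky[OF holF _ F01]) (use that sa0 in \<open>auto simp: F_def\<close>)
    \<comment> \<open>The identity \<open>f z - f a = (w - f a) * (1 - (F y)\<^sup>2)\<close> gives
      the factor \<open>1 + K\<^sup>2\<close>; it is enlarged to \<open>2 + K\<^sup>2\<close>
      because Cauchy's estimate asks for values in an open ball.\<close>
    define B where "B = 2 * (2 + K\<^sup>2) * cmod (deriv f a)"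
    have "cmod ((deriv ^^ 2) f a) \<le> fact 2 * B / (1/4) ^ 2"
    proof (rule Cauchy_higher_deriv_bound[where y = "f a"])
      show "f holomorphic_on ball a (1/4)"
        using holf by (rule holomorphic_on_subset) auto
      show "continuous_on (cball a (1/4)) f"
        by (rule continuous_on_subset[OF holomorphic_on_imp_continuous_on[OF holf]]) auto
      show "f z \<in> ball (f a) B" if "z \<in> ball a (1/4)" for z
      proof -
        define y where "y = 2 * (z - a)"
        have y: "cmod y \<le> 1/2" "z = a + y / 2"
          using that by (simp_all add: y_def norm_mult dist_norm norm_minus_commute
              del: right_diff_distrib_numeral)
        have "w - f z = (w - f a) * (F y)\<^sup>2"
          using F2[of y] y(1) wa by (simp add: y(2) nonzero_divide_eq_eq mult.commute)
        then have "f z - f a = (w - f a) * (1 - (F y)\<^sup>2)"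
          by (simp add: algebra_simps)
        then have "cmod (f z - f a) = cmod (w - f a) * cmod (1 - (F y)\<^sup>2)"
          by (simp add: norm_mult)
        also have "\<dots> \<le> (2 * cmod (deriv f a)) * (1 + K\<^sup>2)"
        proof (intro mult_mono wle)
          have "cmod (1 - (F y)\<^sup>2) \<le> 1 + (cmod (F y))\<^sup>2"
            by (metis norm_one norm_power norm_triangle_ineq4)
          also have "\<dots> \<le> 1 + K\<^sup>2"
            using FK[OF y(1)] by (simp add: power_mono)
          finally show "cmod (1 - (F y)\<^sup>2) \<le> 1 + K\<^sup>2" .
        qed auto
        also have "\<dots> < B" using f'0 by (simp add: B_def algebra_simps)
        finally show ?thesis by (simp add: dist_norm norm_minus_commute)
      qed
    qed auto
    moreover have "fact 2 * B / (1/4) ^ 2 = C * cmod (deriv f a)"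
      by (simp add: B_def C_def power_divide algebra_simps)
    ultimately show ?thesis by (simp add: numeral_2_eq_2)
  qed
  have "C \<ge> 1" unfolding C_def using zero_le_power2[of K] by linarith
  then show thesis using that bound by blast
qed

section \<open>Curve length and the interior path metric\<close>

text \<open>A uniform partition is taken so fine that consecutive points of the curve lie in a
  common disc inside \<open>\<Omega>\<close>. The mean value inequality holds on each such disc by
  convexity, and the inequalities add up to \<open>B\<close> times the length of one inscribed
  polygon.\<close>

lemma dist_le_curve_length_of_bounded_deriv:
  assumes "open \<Omega>" and holf: "f holomorphic_on \<Omega>"
    and bd: "\<And>z. z \<in> \<Omega> \<Longrightarrow> cmod (deriv f z) \<le> B" and "0 < B"
    and "path g" and gsub: "path_image g \<subseteq> \<Omega>"
  shows "ennreal (dist (f (pathstart g)) (f (pathfinish g)) / B) \<le> curve_length g"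
proof -
  obtain e where "e > 0" and e: "(\<Union>x\<in>path_image g. ball x e) \<subseteq> \<Omega>"
    using compact_subset_open_imp_ball_epsilon_subset[OF compact_path_image[OF \<open>path g\<close>] \<open>open \<Omega>\<close> gsub]
    by metis
  have "uniformly_continuous_on {0..1} g"
    using \<open>path g\<close> by (simp add: path_def compact_uniformly_continuous)
  then obtain d where "d > 0"
    and d: "\<And>s t. s \<in> {0..1} \<Longrightarrow> t \<in> {0..1} \<Longrightarrow> dist s t < d \<Longrightarrow> dist (g s) (g t) < e"
    unfolding uniformly_continuous_on_def using \<open>e > 0\<close> by metis
  obtain n where n: "inverse (real (Suc n)) < d"
    using reals_Archimedean[OF \<open>d > 0\<close>] by blast
  define t where "t = (\<lambda>i. real i / real (Suc n))"
  have t01: "t i \<in> {0..1}" if "i \<le> Suc n" for i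
    using that by (simp add: t_def)
  have step: "dist (f (g (t i))) (f (g (t (Suc i)))) \<le> B * dist (g (t i)) (g (t (Suc i)))"
    if "i < Suc n" for i
  proof -
    have "dist (t i) (t (Suc i)) = inverse (real (Suc n))"
      by (simp add: t_def dist_real_def diff_divide_distrib[symmetric] inverse_eq_divide)
    then have close: "g (t (Suc i)) \<in> ball (g (t i)) e"
      using d[of "t i" "t (Suc i)"] n t01[of i] t01[of "Suc i"] that by simp
    have sub: "ball (g (t i)) e \<subseteq> \<Omega>"
      using e t01[of i] that unfolding path_image_def by fastforce
    have "cmod (f (g (t i)) - f (g (t (Suc i)))) \<le> B * cmod (g (t i) - g (t (Suc i)))"
    proof (rule field_differentiable_bound[OF convex_ball])
      show "(f has_field_derivative deriv f z) (at z within ball (g (t i)) e)"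
        if "z \<in> ball (g (t i)) e" for z
        using holf \<open>open \<Omega>\<close> sub that
        by (meson holomorphic_derivI has_field_derivative_at_within subsetD)
    qed (use bd sub close \<open>e > 0\<close> in auto)
    then show ?thesis by (simp add: dist_norm)
  qed
  have "dist (f (g (t 0))) (f (g (t m))) \<le> (\<Sum>i<m. B * dist (g (t i)) (g (t (Suc i))))"
    if "m \<le> Suc n" for m
    using that
  proof (induction m)
    case (Suc m)
    then show ?case
      using step[of m] dist_triangle[of "f (g (t 0))" "f (g (t (Suc m)))" "f (g (t m))"] by simp
  qed simp
  from this[of "Suc n"]
  have "dist (f (pathstart g)) (f (pathfinish g)) \<le> B * (\<Sum>i<Suc n. dist (g (t i)) (g (t (Suc i))))"
    by (simp only: sum_distrib_left) (simp add: t_def pathstart_def pathfinish_def)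
  then have "ennreal (dist (f (pathstart g)) (f (pathfinish g)) / B)
      \<le> ennreal (\<Sum>i<Suc n. dist (g (t i)) (g (t (Suc i))))"
    using \<open>0 < B\<close> by (intro ennreal_leI) (simp add: field_simps)
  also have "\<dots> = (\<Sum>i<Suc n. ennreal (dist (g (t i)) (g (t (Suc i)))))"
    by (rule sum_ennreal[symmetric], rule zero_le_dist)
  also have "\<dots> \<le> curve_length g"
    unfolding curve_length_def
    by (rule SUP_upper2[of "(Suc n, t)"])
       (auto simp: t_def mono_on_def simp del: sum.lessThan_Suc intro!: divide_right_mono)
  finally show ?thesis .
qed

lemma dist_le_interior_path_metric_of_bounded_deriv:
  assumes "open \<Omega>" and "f holomorphic_on \<Omega>"
    and "\<And>z. z \<in> \<Omega> \<Longrightarrow> cmod (deriv f z) \<le> B" and "0 < B"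
  shows "ennreal (dist (f p) (f q) / B) \<le> interior_path_metric \<Omega> p q"
  unfolding interior_path_metric_def
  by (rule INF_greatest)
     (use dist_le_curve_length_of_bounded_deriv[OF assms] in \<open>auto simp: rectifiable_def\<close>)

text \<open>With chords bounded by increments of a single real function, every polygonal sum is
  bounded by a telescoping one. Lengths can thus be bounded above by comparing derivatives, without
  an integral formula.\<close>

lemma curve_length_le_of_dist_le_increment:
  fixes \<phi> :: "real \<Rightarrow> real"
  assumes le: "\<And>s t. 0 \<le> s \<Longrightarrow> s \<le> t \<Longrightarrow> t \<le> 1 \<Longrightarrow> dist (g s) (g t) \<le> \<phi> t - \<phi> s"
  shows "curve_length g \<le> ennreal (\<phi> 1 - \<phi> 0)"
  unfolding curve_length_def
proof (rule SUP_least, clarify)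
  fix n :: nat and t :: "nat \<Rightarrow> real"
  assume t: "t 0 = 0" "t n = 1" and mono: "mono_on {..n} t"
  have step: "dist (g (t i)) (g (t (Suc i))) \<le> \<phi> (t (Suc i)) - \<phi> (t i)" if "i < n" for i
    using mono_onD[OF mono, of 0 i] mono_onD[OF mono, of i "Suc i"] mono_onD[OF mono, of "Suc i" n]
      t that by (intro le) auto
  have "(\<Sum>i<n. ennreal (dist (g (t i)) (g (t (Suc i)))))
      = ennreal (\<Sum>i<n. dist (g (t i)) (g (t (Suc i))))"
    by (rule sum_ennreal) simp
  also have "\<dots> \<le> ennreal (\<Sum>i<n. \<phi> (t (Suc i)) - \<phi> (t i))"
    by (intro ennreal_leI sum_mono step) simp
  also have "(\<Sum>i<n. \<phi> (t (Suc i)) - \<phi> (t i)) = \<phi> 1 - \<phi> 0"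
    using sum_lessThan_telescope[of "\<lambda>i. \<phi> (t i)" n] by (simp add: t)
  finally show "(\<Sum>i<n. ennreal (dist (g (t i)) (g (t (Suc i))))) \<le> ennreal (\<phi> 1 - \<phi> 0)" .
qed

section \<open>The strip and its conformal maps\<close>

text \<open>The image of the right half-plane under \<open>Ln\<close>. Its half-width exceeds 1, so
  unit discs about real points fit inside.\<close>

abbreviation strip :: "complex set" where
  "strip \<equiv> {z. \<bar>Im z\<bar> < pi / 2}"

lemma open_strip: "open strip"
  by (intro open_Collect_less continuous_intros)

lemma convex_strip: "convex strip"
proof -
  have "strip = {z. Im z < pi / 2} \<inter> {z. Im z > - (pi / 2)}" by auto
  then show ?thesis
    by (simp only: convex_Int convex_halfspace_Im_lt convex_halfspace_Im_gt)
qed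

text \<open>The Cayley transform \<open>(1 + w) / (1 - w)\<close> takes the disc to the right
  half-plane, and \<open>Ln\<close> takes that to the strip. For \<open>r\<close> in [0, 1) the
  transform is real and at least 1, so its logarithm is real and nonnegative.\<close>

lemma disc_strip_biholomorphism:
  obtains \<alpha> \<beta> where
    "\<alpha> holomorphic_on ball 0 1" "\<beta> holomorphic_on strip"
    "\<And>w. w \<in> ball 0 1 \<Longrightarrow> \<alpha> w \<in> strip \<and> \<beta> (\<alpha> w) = w"
    "\<And>\<zeta>. \<zeta> \<in> strip \<Longrightarrow> \<beta> \<zeta> \<in> ball 0 1 \<and> \<alpha> (\<beta> \<zeta>) = \<zeta>"
    "\<alpha> 0 = 0" "\<And>r. 0 \<le> r \<Longrightarrow> r < 1 \<Longrightarrow> \<exists>L\<ge>0. \<alpha> (complex_of_real r) = of_real L"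
proof -
  define \<alpha> where "\<alpha> = (\<lambda>w::complex. Ln ((1 + w) / (1 - w)))"
  define \<beta> where "\<beta> = (\<lambda>z::complex. (exp z - 1) / (exp z + 1))"
  have Repos: "Re ((1 + w) / (1 - w)) > 0" if "w \<in> ball 0 1" for w
  proof -
    have "1 - w \<noteq> 0" using that by auto
    moreover have "(Re w)\<^sup>2 + (Im w)\<^sup>2 < 1"
      using that by (simp add: cmod_def)
    moreover have "Re ((1 + w) / (1 - w)) = (1 - ((Re w)\<^sup>2 + (Im w)\<^sup>2)) / (cmod (1 - w))\<^sup>2"
      unfolding cmod_power2 by (simp add: Re_divide) (simp add: power2_eq_square algebra_simps)
    ultimately show ?thesis
      by (simp add: divide_pos_pos)
  qed
  have Reexp: "Re (exp z) > 0" if "z \<in> strip" for z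
    using that cos_gt_zero_pi[of "Im z"] by (simp add: Re_exp)
  have inball: "\<beta> z \<in> ball 0 1" if "z \<in> strip" for z
  proof -
    have "(cmod (exp z - 1))\<^sup>2 < (cmod (exp z + 1))\<^sup>2"
      using Reexp[OF that] unfolding cmod_power2 by (simp add: power2_eq_square algebra_simps)
    then have "cmod (exp z - 1) < cmod (exp z + 1)"
      by (simp add: power2_less_imp_less)
    then show ?thesis
      by (simp add: \<beta>_def norm_divide divide_less_eq)
  qed
  have exp1: "exp z + 1 \<noteq> 0" if "z \<in> strip" for z :: complex
    using Reexp[OF that] by (auto simp: complex_eq_iff)
  show thesis
  proof
    show "\<alpha> holomorphic_on ball 0 1"
      unfolding \<alpha>_def
    proof (intro holomorphic_intros)
      show "(1 + w) / (1 - w) \<notin> \<real>\<^sub>\<le>\<^sub>0" if "w \<in> ball 0 1" for w :: complex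
        using Repos[OF that] by (auto simp: complex_nonpos_Reals_iff)
    qed auto
    show "\<beta> holomorphic_on strip"
      unfolding \<beta>_def using exp1 by (intro holomorphic_intros) auto
    show "\<alpha> w \<in> strip \<and> \<beta> (\<alpha> w) = w" if w: "w \<in> ball 0 1" for w
    proof -
      have ne: "(1 + w) / (1 - w) \<noteq> 0" "1 - w \<noteq> 0" using Repos[OF w] w by force+
      then have "exp (\<alpha> w) = (1 + w) / (1 - w)" by (simp add: \<alpha>_def)
      then show ?thesis
        using Re_Ln_pos_lt_imp[OF Repos[OF w]] ne
        by (simp add: \<beta>_def) (simp add: \<alpha>_def divide_simps)
    qed
    show "\<beta> z \<in> ball 0 1 \<and> \<alpha> (\<beta> z) = z" if z: "z \<in> strip" for z
    proof -
      have "(1 + \<beta> z) / (1 - \<beta> z) = exp z"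
        using exp1[OF z] by (simp add: \<beta>_def divide_simps)
      then show ?thesis
        using inball[OF z] z pi_gt_zero unfolding \<alpha>_def by (auto intro!: Ln_exp)
    qed
    show "\<alpha> 0 = 0" by (simp add: \<alpha>_def)
    show "\<exists>L\<ge>0. \<alpha> (complex_of_real r) = of_real L" if r: "0 \<le> r" "r < 1" for r
    proof (intro exI conjI)
      have ge: "(1 + r) / (1 - r) \<ge> 1" using r by (simp add: divide_simps)
      then show "0 \<le> ln ((1 + r) / (1 - r))" by simp
      show "\<alpha> (complex_of_real r) = of_real (ln ((1 + r) / (1 - r)))"
        using ge Ln_of_real[of "(1 + r) / (1 - r)"] by (simp add: \<alpha>_def)
    qed
  qed
qed

text \<open>A Riemann map is followed by a disc automorphism sending the image of \<open>p\<close>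
  to 0, a rotation making the image of \<open>q\<close> a nonnegative real, and the map from disc to
  strip.\<close>

lemma strip_biholomorphism_through_points:
  assumes "open \<Omega>" "simply_connected \<Omega>" "\<Omega> \<noteq> UNIV" and p: "p \<in> \<Omega>" and q: "q \<in> \<Omega>"
  obtains L \<Psi> \<Phi> where "0 \<le> L" "\<Psi> holomorphic_on strip" "\<Phi> holomorphic_on \<Omega>"
    "\<forall>\<zeta>\<in>strip. \<Psi> \<zeta> \<in> \<Omega> \<and> \<Phi> (\<Psi> \<zeta>) = \<zeta>"
    "\<forall>z\<in>\<Omega>. \<Phi> z \<in> strip \<and> \<Psi> (\<Phi> z) = z"
    "\<Psi> 0 = p" "\<Psi> (complex_of_real L) = q"
proof -
  obtain f g where f: "f holomorphic_on \<Omega>" and g: "g holomorphic_on ball 0 1"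
    and fg: "\<And>z. z \<in> \<Omega> \<Longrightarrow> f z \<in> ball 0 1 \<and> g (f z) = z"
    and gf: "\<And>z. z \<in> ball 0 1 \<Longrightarrow> g z \<in> \<Omega> \<and> f (g z) = z"
    using iffD1[OF simply_connected_eq_biholomorphic_to_disc[OF \<open>open \<Omega>\<close>] \<open>simply_connected \<Omega>\<close>]
      \<open>\<Omega> \<noteq> UNIV\<close> p by blast
  have "f p \<in> ball 0 1" using fg p by blast
  then obtain m k where m0: "m (f p) = 0"
    and m: "m holomorphic_on ball 0 1" "m ` ball 0 1 \<subseteq> ball 0 1"
    and k: "k holomorphic_on ball 0 1" "k ` ball 0 1 \<subseteq> ball 0 1"
    and mk: "\<And>z. z \<in> ball 0 1 \<Longrightarrow> m (k z) = z" and km: "\<And>z. z \<in> ball 0 1 \<Longrightarrow> k (m z) = z"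
    using ball_biholomorphism_exists by blast
  obtain \<alpha> \<beta> where \<alpha>: "\<alpha> holomorphic_on ball 0 1" and \<beta>: "\<beta> holomorphic_on strip"
    and \<beta>\<alpha>: "\<And>w. w \<in> ball 0 1 \<Longrightarrow> \<alpha> w \<in> strip \<and> \<beta> (\<alpha> w) = w"
    and \<alpha>\<beta>: "\<And>\<zeta>. \<zeta> \<in> strip \<Longrightarrow> \<beta> \<zeta> \<in> ball 0 1 \<and> \<alpha> (\<beta> \<zeta>) = \<zeta>"
    and \<alpha>0: "\<alpha> 0 = 0"
    and \<alpha>L: "\<And>r. 0 \<le> r \<Longrightarrow> r < 1 \<Longrightarrow> \<exists>L\<ge>0. \<alpha> (complex_of_real r) = of_real L"
    by (rule disc_strip_biholomorphism) blast
  define r where "r = cmod (m (f q))"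
  \<comment> \<open>The phase of \<open>m (f q)\<close>. Since \<open>sgn 0 = 0\<close>, the case
    \<open>m (f q) = 0\<close>, which means \<open>p = q\<close>, is assigned 1 to keep
    \<open>u\<close> invertible.\<close>
  define u where "u = (if m (f q) = 0 then 1 else sgn (m (f q)))"
  have u: "cmod u = 1" "m (f q) = u * of_real r"
    by (auto simp: u_def r_def norm_divide sgn_eq)
  then have u0: "u \<noteq> 0" by auto
  have "m (f q) \<in> ball 0 1" using m(2) fg[OF q] by blast
  then have r: "0 \<le> r" "r < 1" by (simp_all add: r_def)
  obtain L where L: "L \<ge> 0" "\<alpha> (complex_of_real r) = of_real L"
    using \<alpha>L[OF r] by blast
  define \<Phi> where "\<Phi> = (\<lambda>z. \<alpha> (m (f z) / u))"
  define \<Psi> where "\<Psi> = (\<lambda>\<zeta>. g (k (u * \<beta> \<zeta>)))"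
  have mf: "m (f z) \<in> ball 0 1" if "z \<in> \<Omega>" for z
    using m(2) fg[OF that] by blast
  have divu: "w / u \<in> ball 0 1" if "w \<in> ball 0 1" for w
    using that u by (simp add: norm_divide)
  have mulu: "u * w \<in> ball 0 1" if "w \<in> ball 0 1" for w
    using that u by (simp add: norm_mult)
  have PP: "\<Psi> \<zeta> \<in> \<Omega> \<and> \<Phi> (\<Psi> \<zeta>) = \<zeta>" if "\<zeta> \<in> strip" for \<zeta>
  proof -
    have 1: "u * \<beta> \<zeta> \<in> ball 0 1" using mulu \<alpha>\<beta>[OF that] by blast
    then have "k (u * \<beta> \<zeta>) \<in> ball 0 1" using k(2) by blast
    then show ?thesis
      using gf mk[OF 1] \<alpha>\<beta>[OF that] u0 by (simp add: \<Psi>_def \<Phi>_def)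
  qed
  have QQ: "\<Phi> z \<in> strip \<and> \<Psi> (\<Phi> z) = z" if "z \<in> \<Omega>" for z
    using \<beta>\<alpha>[OF divu[OF mf[OF that]]] km[of "f z"] fg[OF that] u0 by (simp add: \<Psi>_def \<Phi>_def)
  have \<Phi>hol: "\<Phi> holomorphic_on \<Omega>"
    unfolding \<Phi>_def using u0 fg divu mf
    by (intro holomorphic_on_compose_gen[OF _ \<alpha>, unfolded o_def] holomorphic_intros
        holomorphic_on_compose_gen[OF f m(1), unfolded o_def]) auto
  have \<Psi>hol: "\<Psi> holomorphic_on strip"
    unfolding \<Psi>_def using mulu \<alpha>\<beta> k(2)
    by (intro holomorphic_on_compose_gen[OF _ g, unfolded o_def]
        holomorphic_on_compose_gen[OF _ k(1), unfolded o_def] holomorphic_intros \<beta>) blast+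
  have "\<Phi> p = 0" "\<Phi> q = of_real L"
    using u0 m0 \<alpha>0 u(2) L(2) by (simp_all add: \<Phi>_def)
  then have "\<Psi> 0 = p" "\<Psi> (of_real L) = q"
    using QQ[OF p] QQ[OF q] by simp_all
  then show thesis
    using that[of L \<Psi> \<Phi>] L(1) PP QQ \<Phi>hol \<Psi>hol by blast
qed

section \<open>Compensating a slowly varying phase by a bounded holomorphic function\<close>

text \<open>The lower bound holds because \<open>cos d \<ge> 1 - d\<^sup>2 / 2\<close> and
  \<open>1 - C\<^sup>2 t\<^sup>2 / 2 = 3/4 + (1 - 2 C\<^sup>2 t\<^sup>2) / 4\<close>, where \<open>(1 - 2 C\<^sup>2 t\<^sup>2) exp (- C\<^sup>2 t\<^sup>2)\<close> is the
  derivative of \<open>t exp (- C\<^sup>2 t\<^sup>2)\<close>.\<close>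

lemma lipschitz_phase_holomorphic_approximation:
  fixes \<theta> :: "real \<Rightarrow> real"
  assumes C: "1 \<le> C" and lip: "\<And>s t. \<bar>\<theta> s - \<theta> t\<bar> \<le> C * \<bar>s - t\<bar>" and L: "0 \<le> L"
  obtains h where "h holomorphic_on UNIV"
    "\<forall>\<zeta>\<in>strip. cmod (h \<zeta>) \<le> pi * exp (4 * C\<^sup>2)"
    "\<forall>x\<in>{0..L}. Re (h (of_real x) * cis (\<theta> x)) \<ge> 3/4 * exp (- C\<^sup>2)"
proof -
  define N where "N = C\<^sup>2"
  have N: "N \<ge> 1" using C by (simp add: N_def)
  \<comment> \<open>The conjugate phase against a Gaussian that is entire in \<open>\<zeta>\<close>.
    The choice \<open>N = C\<^sup>2\<close> gives the Gaussian width of order \<open>1 / C\<close>,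
    the scale on which the phase can change.\<close>
  define k where "k = (\<lambda>\<zeta> s. cis (- \<theta> s) * exp (- (of_real N * (\<zeta> - of_real s)\<^sup>2)))"
  \<comment> \<open>The extra unit of length puts \<open>{x..x + 1}\<close> inside the range of
    integration for every \<open>x\<close> in \<open>{0..L}\<close>; on that interval the real
    Gaussian is at least \<open>exp (- N)\<close>.\<close>
  define h where "h = (\<lambda>\<zeta>. integral {0..L + 1} (k \<zeta>))"
  have cont: "continuous_on A \<theta>" for A
    by (rule lipschitz_on_continuous_on[of C]) (use lip C in \<open>auto simp: lipschitz_on_def dist_real_def\<close>)
  have cont': "continuous_on A (\<lambda>p. \<theta> (f p))" if "continuous_on A f" for A and f :: "'b::topological_space \<Rightarrow> real"
    using continuous_on_compose2[OF cont that] by blast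
  have kint: "k \<zeta> integrable_on {a..b}" for \<zeta> a b
    unfolding k_def by (intro integrable_continuous_real continuous_intros cont')
  have holh: "h holomorphic_on UNIV"
    unfolding h_def cbox_interval[symmetric]
  proof (rule leibniz_rule_holomorphic)
    show "((\<lambda>\<zeta>. k \<zeta> t) has_field_derivative
            cis (- \<theta> t) * (exp (- (of_real N * (\<zeta> - of_real t)\<^sup>2)) * (- (of_real N * (2 * (\<zeta> - of_real t))))))
           (at \<zeta> within UNIV)" for \<zeta> t
      unfolding k_def by (auto intro!: derivative_eq_intros)
    show "continuous_on (UNIV \<times> cbox 0 (L + 1)) (\<lambda>(\<zeta>, t). cis (- \<theta> t) *
            (exp (- (of_real N * (\<zeta> - of_real t)\<^sup>2)) * (- (of_real N * (2 * (\<zeta> - of_real t))))))"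
      unfolding split_beta by (intro continuous_intros cont')
  qed (use kint in auto)
  \<comment> \<open>At height \<open>y\<close> the Gaussian has modulus
    \<open>exp (- (N * (t\<^sup>2 - y\<^sup>2)))\<close>. In the strip
    \<open>y\<^sup>2 \<le> 4\<close>, which costs \<open>exp (4 * N)\<close>; the rest is at most
    \<open>1 / (1 + t\<^sup>2)\<close>, whose integral, a difference of arctangents, is at most
    \<open>pi\<close>.\<close>
  have bound: "cmod (h \<zeta>) \<le> pi * exp (4 * N)" if "\<zeta> \<in> strip" for \<zeta>
  proof -
    define x y where "x = Re \<zeta>" and "y = Im \<zeta>"
    have "\<bar>y\<bar> \<le> 2" using that pi_less_4 by (simp add: y_def)
    then have y2: "y\<^sup>2 \<le> 4" using power_mono[of "\<bar>y\<bar>" 2 2] by simp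
    have int: "((\<lambda>s. exp (4 * N) * (1 / (1 + (s - x)\<^sup>2))) has_integral
          exp (4 * N) * (arctan (L + 1 - x) - arctan (0 - x))) {0..L + 1}"
    proof (intro has_integral_mult_right fundamental_theorem_of_calculus)
      show "((\<lambda>s. arctan (s - x)) has_vector_derivative 1 / (1 + (s - x)\<^sup>2)) (at s within {0..L + 1})" for s
        unfolding has_real_derivative_iff_has_vector_derivative[symmetric]
        by (auto intro!: derivative_eq_intros simp: inverse_eq_divide)
    qed (use L in auto)
    have "cmod (h \<zeta>) \<le> integral {0..L + 1} (\<lambda>s. exp (4 * N) * (1 / (1 + (s - x)\<^sup>2)))"
      unfolding h_def
    proof (rule integral_norm_bound_integral[OF kint has_integral_integrable[OF int]])
      fix s
      define t where "t = s - x"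
      have "cmod (k \<zeta> s) = exp (- (N * (t\<^sup>2 - y\<^sup>2)))"
        by (simp add: k_def norm_mult t_def x_def y_def power2_eq_square algebra_simps)
      also have "\<dots> \<le> exp (4 * N) * exp (- t\<^sup>2)"
      proof -
        have "N * y\<^sup>2 \<le> N * 4" "1 * t\<^sup>2 \<le> N * t\<^sup>2"
          using y2 N by (intro mult_left_mono mult_right_mono; simp)+
        then show ?thesis by (simp add: right_diff_distrib flip: exp_add)
      qed
      also have "\<dots> \<le> exp (4 * N) * (1 / (1 + t\<^sup>2))"
        using exp_ge_add_one_self[of "t\<^sup>2"]
        by (simp add: exp_minus inverse_eq_divide) (intro divide_left_mono; simp add: add_pos_nonneg)
      finally show "cmod (k \<zeta> s) \<le> exp (4 * N) * (1 / (1 + (s - x)\<^sup>2))"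
        by (simp add: t_def)
    qed
    also have "\<dots> = exp (4 * N) * (arctan (L + 1 - x) - arctan (0 - x))"
      using int by (rule integral_unique)
    also have "\<dots> \<le> exp (4 * N) * pi"
      using arctan_bounded[of "L + 1 - x"] arctan_bounded[of "0 - x"] by (intro mult_left_mono) auto
    finally show ?thesis by (simp add: mult.commute)
  qed
  have lower: "Re (h (of_real x) * cis (\<theta> x)) \<ge> 3/4 * exp (- N)" if x: "0 \<le> x" "x \<le> L" for x
  proof -
    define e where "e = (\<lambda>s. exp (- (N * (s - x)\<^sup>2)))"
    have eint: "e integrable_on {a..b}" for a b
      unfolding e_def by (intro integrable_continuous_real continuous_intros)
    have g: "((\<lambda>s. Re (k (of_real x) s * cis (\<theta> x))) has_integral Re (h (of_real x) * cis (\<theta> x))) {0..L + 1}"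
      unfolding h_def using kint
      by (intro has_integral_linear[OF _ bounded_linear_Re, unfolded o_def] has_integral_mult_left
          integrable_integral)
    have f: "((\<lambda>s. 1/4 * ((1 - 2 * N * (s - x)\<^sup>2) * e s) + 3/4 * e s) has_integral
        1/4 * ((L + 1 - x) * e (L + 1) - (0 - x) * e 0) + 3/4 * integral {0..L + 1} e) {0..L + 1}"
    proof (intro has_integral_add has_integral_mult_right fundamental_theorem_of_calculus)
      show "((\<lambda>s. (s - x) * e s) has_vector_derivative (1 - 2 * N * (s - x)\<^sup>2) * e s) (at s within {0..L + 1})" for s
        unfolding has_real_derivative_iff_has_vector_derivative[symmetric] e_def
        by (auto intro!: derivative_eq_intros simp: algebra_simps power2_eq_square)
    qed (use L eint in \<open>auto intro: integrable_integral\<close>)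
    have le: "1/4 * ((1 - 2 * N * (s - x)\<^sup>2) * e s) + 3/4 * e s \<le> Re (k (of_real x) s * cis (\<theta> x))" for s
    proof -
      have "(\<theta> x - \<theta> s)\<^sup>2 \<le> N * (s - x)\<^sup>2"
        using power_mono[OF lip[of x s], of 2] by (simp add: N_def power_mult_distrib power2_commute)
      moreover have "cos (\<theta> x - \<theta> s) \<ge> 1 - (\<theta> x - \<theta> s)\<^sup>2 / 2"
        using cos_double_sin[of "(\<theta> x - \<theta> s) / 2"]
          power_mono[OF abs_sin_x_le_abs_x[of "(\<theta> x - \<theta> s) / 2"], of 2]
        by (simp add: power_divide del: left_diff_distrib_numeral right_diff_distrib_numeral)
      ultimately have "(1 - N * (s - x)\<^sup>2 / 2) * e s \<le> cos (\<theta> x - \<theta> s) * e s"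
        by (intro mult_right_mono) (auto simp: e_def)
      moreover have "k (of_real x) s = cis (- \<theta> s) * of_real (e s)"
        by (simp add: k_def e_def power2_commute exp_of_real[symmetric])
      then have "k (of_real x) s * cis (\<theta> x) = of_real (e s) * cis (\<theta> x - \<theta> s)"
        by (simp add: cis_mult mult_ac)
      ultimately show ?thesis by (simp add: algebra_simps)
    qed
    have "1/4 * ((L + 1 - x) * e (L + 1) - (0 - x) * e 0) + 3/4 * integral {0..L + 1} e
        \<le> Re (h (of_real x) * cis (\<theta> x))"
      using f g le by (rule has_integral_le)
    \<comment> \<open>Both boundary terms of the exact derivative are nonnegative because
      \<open>x\<close> lies in \<open>{0..L}\<close>, so they may be dropped from the lower
      bound.\<close>
    moreover have "(L + 1 - x) * e (L + 1) - (0 - x) * e 0 \<ge> 0"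
      using x by (simp add: e_def)
    moreover have "exp (- N) \<le> integral {0..L + 1} e"
    proof -
      have "exp (- N) = integral {x..x + 1} (\<lambda>_. exp (- N))" by simp
      also have "\<dots> \<le> integral {x..x + 1} e"
      proof (rule integral_le[OF _ eint])
        fix s assume "s \<in> {x..x + 1}"
        then have "(s - x)\<^sup>2 \<le> 1" using power_le_one[of "s - x" 2] by simp
        then show "exp (- N) \<le> e s"
          using N by (simp add: e_def mult_left_le)
      qed auto
      also have "\<dots> \<le> integral {0..L + 1} e"
        by (rule integral_subset_le[OF _ eint eint]) (use x in \<open>auto simp: e_def\<close>)
      finally show ?thesis .
    qed
    ultimately show ?thesis by argo
  qed
  show thesis
    using that[OF holh] bound lower unfolding N_def by simp
qed

section \<open>The logarithm of the derivative and the test functions\<close>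

text \<open>The real line itself serves as the convex set in the mean value inequality, so a
  derivative bound at real points suffices. It is used to show that the phase \<open>Im g\<close> is
  Lipschitz on the real axis.\<close>

lemma real_axis_increment_bound:
  fixes g :: "complex \<Rightarrow> complex"
  assumes holg: "g holomorphic_on S" and "open S" and "\<real> \<subseteq> S"
    and bd: "\<And>x. cmod (deriv g (of_real x)) \<le> C"
  shows "cmod (g (of_real s) - g (of_real t)) \<le> C * \<bar>s - t\<bar>"
proof -
  have "cmod (g (of_real s) - g (of_real t)) \<le> C * cmod (of_real s - of_real t)"
  proof (rule field_differentiable_bound[where S = "\<real>"])
    show "convex (\<real> :: complex set)"
      by (auto simp: convex_def scaleR_conv_of_real intro!: Reals_add Reals_mult)
    show "(g has_field_derivative deriv g z) (at z within \<real>)" if "z \<in> \<real>" for z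
      using that holg \<open>open S\<close> \<open>\<real> \<subseteq> S\<close>
      by (meson holomorphic_derivI has_field_derivative_at_within subsetD)
  qed (use bd in \<open>auto elim!: Reals_cases\<close>)
  then show ?thesis by (simp flip: of_real_diff)
qed

text \<open>A holomorphic logarithm \<open>g\<close> of the nonvanishing \<open>deriv \<Psi>\<close>
  has as derivative the quotient of the second and first derivatives of \<open>\<Psi>\<close>. At a
  real point the distortion bound controls this quotient, since the unit disc about the point lies
  in the strip.\<close>

lemma log_deriv_of_strip_map:
  assumes hol: "\<Psi> holomorphic_on strip" and inj: "inj_on \<Psi> strip"
    and C: "\<And>f a. f holomorphic_on ball a 1 \<Longrightarrow> inj_on f (ball a 1) \<Longrightarrow>
       cmod (deriv (deriv f) a) \<le> C * cmod (deriv f a)"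
  obtains g where "g holomorphic_on strip" "\<forall>\<zeta>\<in>strip. deriv \<Psi> \<zeta> = exp (g \<zeta>)"
    "\<forall>x. cmod (deriv g (complex_of_real x)) \<le> C"
proof -
  have "deriv \<Psi> holomorphic_on strip"
    using hol open_strip by (rule holomorphic_deriv)
  moreover have "\<forall>\<zeta> \<in> strip. deriv \<Psi> \<zeta> \<noteq> 0"
    using holomorphic_injective_imp_regular[OF hol open_strip inj] by blast
  moreover have "simply_connected strip"
    using convex_strip by (rule convex_imp_simply_connected)
  ultimately obtain g where holg: "g holomorphic_on strip"
    and g: "\<And>\<zeta>. \<zeta> \<in> strip \<Longrightarrow> deriv \<Psi> \<zeta> = exp (g \<zeta>)"
    using iffD1[OF simply_connected_eq_holomorphic_log[OF open_strip]] by blast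
  have "cmod (deriv g (complex_of_real x)) \<le> C" for x
  proof -
    let ?x = "complex_of_real x"
    have x: "?x \<in> strip" by simp
    have "ball ?x 1 \<subseteq> strip"
    proof
      fix z assume "z \<in> ball ?x 1"
      then have "\<bar>Im z\<bar> < 1"
        using abs_Im_le_cmod[of "z - ?x"] by (simp add: dist_norm norm_minus_commute)
      then show "z \<in> strip" using pi_gt3 by simp
    qed
    then have "cmod (deriv (deriv \<Psi>) ?x) \<le> C * cmod (deriv \<Psi> ?x)"
      using C holomorphic_on_subset[OF hol] inj_on_subset[OF inj] by blast
    moreover have "deriv (deriv \<Psi>) ?x = exp (g ?x) * deriv g ?x"
    proof -
      have "((\<lambda>\<zeta>. exp (g \<zeta>)) has_field_derivative exp (g ?x) * deriv g ?x) (at ?x)"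
        using holomorphic_derivI[OF holg open_strip x] by (auto intro!: derivative_eq_intros)
      moreover have "eventually (\<lambda>\<zeta>. deriv \<Psi> \<zeta> = exp (g \<zeta>)) (nhds ?x)"
        using eventually_nhds_in_open[OF open_strip x] by (rule eventually_mono) (rule g)
      ultimately show ?thesis
        by (simp add: deriv_cong_ev DERIV_imp_deriv)
    qed
    ultimately show ?thesis
      using g[OF x] by (simp add: norm_mult)
  qed
  then show thesis using that holg g by blast
qed

text \<open>With \<open>\<Psi>\<close> the strip map and \<open>deriv \<Psi> = exp g\<close>, take for the derivative of the test function
  \<open>h (\<Phi> z)\<close>, where \<open>h\<close> approximates the conjugate phase \<open>exp (- \<i> Im g)\<close> on the real axis.\<close>

lemma test_functions_for_interior_path_metric:
  obtains M :: real where "M > 0"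
    "\<And>\<Omega> p q. open \<Omega> \<Longrightarrow> simply_connected \<Omega> \<Longrightarrow> \<Omega> \<noteq> UNIV \<Longrightarrow> p \<in> \<Omega> \<Longrightarrow> q \<in> \<Omega> \<Longrightarrow>
      \<exists>f. f holomorphic_on \<Omega> \<and> (\<forall>z\<in>\<Omega>. cmod (deriv f z) \<le> M) \<and>
          interior_path_metric \<Omega> p q \<le> ennreal (dist (f p) (f q))"
proof -
  obtain C :: real where C: "C \<ge> 1"
    "\<And>f a. f holomorphic_on ball a 1 \<Longrightarrow> inj_on f (ball a 1) \<Longrightarrow>
       cmod (deriv (deriv f) a) \<le> C * cmod (deriv f a)"
    by (rule injective_holomorphic_second_deriv_bound) blast
  \<comment> \<open>The lower bound for the real part of \<open>h\<close> times the phase. Dividing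
    \<open>h\<close> by \<open>c\<close> makes the increment of the primitive dominate length with
    constant 1, and \<open>M\<close> is the resulting bound on the derivative.\<close>
  define c where "c = 3/4 * exp (- C\<^sup>2)"
  have c: "c > 0" by (simp add: c_def)
  define M where "M = pi * exp (4 * C\<^sup>2) / c"
  have "\<exists>f. f holomorphic_on \<Omega> \<and> (\<forall>z\<in>\<Omega>. cmod (deriv f z) \<le> M) \<and>
          interior_path_metric \<Omega> p q \<le> ennreal (dist (f p) (f q))"
    if \<Omega>: "open \<Omega>" "simply_connected \<Omega>" "\<Omega> \<noteq> UNIV" and p: "p \<in> \<Omega>" and q: "q \<in> \<Omega>"
    for \<Omega> p q
  proof -
    obtain L \<Psi> \<Phi> where L: "0 \<le> L" and hol\<Psi>: "\<Psi> holomorphic_on strip"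
      and hol\<Phi>: "\<Phi> holomorphic_on \<Omega>"
      and \<Phi>\<Psi>: "\<forall>\<zeta>\<in>strip. \<Psi> \<zeta> \<in> \<Omega> \<and> \<Phi> (\<Psi> \<zeta>) = \<zeta>"
      and \<Psi>\<Phi>: "\<forall>z\<in>\<Omega>. \<Phi> z \<in> strip \<and> \<Psi> (\<Phi> z) = z"
      and ends: "\<Psi> 0 = p" "\<Psi> (complex_of_real L) = q"
      using strip_biholomorphism_through_points[OF \<Omega> p q] .
    have inj: "inj_on \<Psi> strip"
      using \<Phi>\<Psi> by (intro inj_on_inverseI[of _ \<Phi>]) blast
    obtain g where holg: "g holomorphic_on strip"
      and g: "\<forall>\<zeta>\<in>strip. deriv \<Psi> \<zeta> = exp (g \<zeta>)"
      and g': "\<forall>x. cmod (deriv g (complex_of_real x)) \<le> C"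
      using log_deriv_of_strip_map[OF hol\<Psi> inj C(2)] .
    have "\<real> \<subseteq> strip" by (auto elim: Reals_cases)
    then have lip: "\<bar>Im (g (of_real s)) - Im (g (of_real t))\<bar> \<le> C * \<bar>s - t\<bar>" for s t
      using real_axis_increment_bound[OF holg open_strip _ spec[OF g'], of s t]
        abs_Im_le_cmod[of "g (of_real s) - g (of_real t)"] by simp
    obtain h where holh: "h holomorphic_on UNIV"
      and hM: "\<forall>\<zeta>\<in>strip. cmod (h \<zeta>) \<le> pi * exp (4 * C\<^sup>2)"
      and hc: "\<forall>x\<in>{0..L}. Re (h (of_real x) * cis (Im (g (of_real x)))) \<ge> c"
      using lipschitz_phase_holomorphic_approximation[OF C(1) lip L, folded c_def] .
    have "(\<lambda>z. h (\<Phi> z) / of_real c) holomorphic_on \<Omega>"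
      using c by (intro holomorphic_intros holomorphic_on_compose_gen[OF hol\<Phi> holh, unfolded o_def]) auto
    then obtain F where F: "\<And>z. z \<in> \<Omega> \<Longrightarrow> (F has_field_derivative h (\<Phi> z) / of_real c) (at z)"
      using iffD1[OF simply_connected_eq_global_primitive[OF \<Omega>(1)] \<Omega>(2)] by blast
    have holF: "F holomorphic_on \<Omega>"
      using F \<Omega>(1) by (meson holomorphic_on_open)
    have F': "cmod (deriv F z) \<le> M" if "z \<in> \<Omega>" for z
      using DERIV_imp_deriv[OF F[OF that]] bspec[OF hM, of "\<Phi> z"] bspec[OF \<Psi>\<Phi> that] c
      by (simp add: M_def norm_divide divide_right_mono)
    \<comment> \<open>Its derivative is the real part of \<open>h / c * exp g\<close>. Writing
      \<open>exp g\<close> in polar form shows that on \<open>{0..L}\<close> this is at least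
      \<open>cmod (exp g)\<close>, the speed of the image curve, so increments of
      \<open>\<phi>\<close> dominate chords.\<close>
    define \<phi> where "\<phi> = (\<lambda>x. Re (F (\<Psi> (of_real x))))"
    have d\<Psi>: "((\<lambda>x. \<Psi> (of_real x)) has_vector_derivative exp (g (of_real x))) (at x within A)" for x A
      using holomorphic_derivI[OF hol\<Psi> open_strip, of "of_real x"] bspec[OF g, of "of_real x"]
      by (intro has_vector_derivative_real_field) simp
    have d\<phi>: "(\<phi> has_vector_derivative Re (h (of_real x) / of_real c * exp (g (of_real x)))) (at x within A)" for x A
    proof -
      have x: "of_real x \<in> strip" by simp
      have "((\<lambda>\<zeta>. F (\<Psi> \<zeta>)) has_field_derivative h (of_real x) / of_real c * exp (g (of_real x))) (at (of_real x))"
        using DERIV_chain2[OF F holomorphic_derivI[OF hol\<Psi> open_strip x]] bspec[OF \<Phi>\<Psi> x] bspec[OF g x] by simp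
      then have "((\<lambda>x. F (\<Psi> (of_real x))) has_vector_derivative h (of_real x) / of_real c * exp (g (of_real x))) (at x within A)"
        by (rule has_vector_derivative_real_field)
      then show ?thesis
        unfolding \<phi>_def by (rule bounded_linear.has_vector_derivative[OF bounded_linear_Re])
    qed
    have incr: "dist (\<Psi> (of_real a)) (\<Psi> (of_real b)) \<le> \<phi> b - \<phi> a"
      if ab: "0 \<le> a" "a \<le> b" "b \<le> L" for a b
    proof (cases "a = b")
      case False
      have "cmod (\<Psi> (of_real b) - \<Psi> (of_real a)) \<le> \<phi> b - \<phi> a"
      proof (rule differentiable_bound_general[OF _ _ _ d\<Psi> d\<phi>])
        show "continuous_on {a..b} (\<lambda>x. \<Psi> (of_real x))" "continuous_on {a..b} \<phi>"
          by (rule continuous_on_vector_derivative, rule d\<Psi> d\<phi>)+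
        fix x assume x: "a < x" "x < b"
        have "cmod (exp (g (of_real x))) = exp (Re (g (of_real x))) * (c / c)"
          using c by simp
        also have "\<dots> \<le> exp (Re (g (of_real x))) * (Re (h (of_real x) * cis (Im (g (of_real x)))) / c)"
          using bspec[OF hc, of x] x ab c by (intro mult_left_mono divide_right_mono) auto
        also have "\<dots> = Re (h (of_real x) / of_real c * exp (g (of_real x)))"
          by (simp add: exp_eq_polar[of "g (of_real x)"] algebra_simps)
        finally show "cmod (exp (g (of_real x))) \<le> Re (h (of_real x) / of_real c * exp (g (of_real x)))" .
      qed (use ab False in auto)
      then show ?thesis by (simp add: dist_norm norm_minus_commute)
    qed simp
    define \<gamma> where "\<gamma> = (\<lambda>t. \<Psi> (of_real (L * t)))"
    have "curve_length \<gamma> \<le> ennreal (\<phi> (L * 1) - \<phi> (L * 0))"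
      unfolding \<gamma>_def
      by (rule curve_length_le_of_dist_le_increment, rule incr)
         (use L in \<open>auto intro: mult_left_mono simp: mult_left_le\<close>)
    also have "\<dots> \<le> ennreal (dist (F p) (F q))"
      using ends complex_Re_le_cmod[of "F q - F p"]
      by (intro ennreal_leI) (simp add: \<phi>_def dist_norm norm_minus_commute)
    finally have len: "curve_length \<gamma> \<le> ennreal (dist (F p) (F q))" .
    have "path \<gamma>"
      unfolding path_def \<gamma>_def
      by (rule continuous_on_compose2[OF holomorphic_on_imp_continuous_on[OF hol\<Psi>]])
         (auto intro!: continuous_intros)
    moreover have "curve_length \<gamma> < \<infinity>"
      using len by (rule order_le_less_trans) simp
    moreover have "path_image \<gamma> \<subseteq> \<Omega>" "pathstart \<gamma> = p" "pathfinish \<gamma> = q"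
      using \<Phi>\<Psi> ends by (auto simp: path_image_def pathstart_def pathfinish_def \<gamma>_def)
    ultimately have "interior_path_metric \<Omega> p q \<le> curve_length \<gamma>"
      unfolding interior_path_metric_def rectifiable_def by (intro INF_lower) simp
    then show ?thesis
      using holF F' len by (meson order_trans)
  qed
  moreover have "M > 0" using c by (simp add: M_def)
  ultimately show thesis using that by blast
qed

section \<open>The gliding hump\<close>

text \<open>A gliding hump: each step adds a small multiple of a test function for a pair of points so
  far apart that the increment of the new term between them dominates that of the bounded partial
  sum. The metric controls the increments of all later terms.\<close>

lemma unbounded_of_test_functions:
  assumes \<Omega>: "open \<Omega>" "simply_connected \<Omega>" and M: "M > 0"
    and test: "\<And>p q. p \<in> \<Omega> \<Longrightarrow> q \<in> \<Omega> \<Longrightarrow>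
      \<exists>f. f holomorphic_on \<Omega> \<and> (\<forall>z\<in>\<Omega>. cmod (deriv f z) \<le> M) \<and>
          interior_path_metric \<Omega> p q \<le> ennreal (dist (f p) (f q))"
    and infinite: "(SUP (p, q) \<in> \<Omega> \<times> \<Omega>. interior_path_metric \<Omega> p q) = \<infinity>"
  shows "\<exists>f. f holomorphic_on \<Omega> \<and> \<not> bounded (f ` \<Omega>) \<and> bounded (deriv f ` \<Omega>)"
proof (rule ccontr)
  \<comment> \<open>Under the negation every holomorphic function on \<open>\<Omega>\<close> with
    bounded derivative is bounded. This applies to each partial sum and, at the end, to the
    limit.\<close>
  assume contr: "\<not> ?thesis"
  \<comment> \<open>Chosen so that \<open>M * (\<delta> / (1 - \<delta>)) = 1 / 2\<close>: the terms
    after step \<open>n\<close> then have derivatives summing to at most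
    \<open>\<delta> ^ n / 2\<close>.\<close>
  define \<delta> where "\<delta> = 1 / (2 * M + 1)"
  have \<delta>: "0 < \<delta>" "\<delta> < 1" using M by (auto simp: \<delta>_def)
  define ok where "ok = (\<lambda>S::complex \<Rightarrow> complex. S holomorphic_on \<Omega> \<and> bounded (deriv S ` \<Omega>))"
  have ok_bounded: "\<exists>B. \<forall>p\<in>\<Omega>. \<forall>q\<in>\<Omega>. dist (S p) (S q) \<le> B" if "ok S" for S
  proof -
    have "bounded (S ` \<Omega>)" using that contr by (auto simp: ok_def)
    then show ?thesis by (auto simp: bounded_two_points)
  qed
  \<comment> \<open>\<open>D\<close> is a real bound for the extended-valued metric. The surplus
    \<open>\<delta> ^ n / 2 * D\<close> in the increment pays for all later terms, leaving at least
    \<open>n\<close>.\<close>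
  define step where "step = (\<lambda>n S S'. (\<forall>z\<in>\<Omega>. cmod (deriv S' z - deriv S z) \<le> M * \<delta> ^ n) \<and>
    (\<exists>p\<in>\<Omega>. \<exists>q\<in>\<Omega>. \<exists>D\<ge>0. interior_path_metric \<Omega> p q \<le> ennreal D \<and>
       real n + \<delta> ^ n / 2 * D \<le> dist (S' p) (S' q :: complex)))"
  have "\<exists>S'. ok S' \<and> step n S S'" if okS: "ok S" for S n
  proof -
    obtain B where B: "\<forall>p\<in>\<Omega>. \<forall>q\<in>\<Omega>. dist (S p) (S q) \<le> B" using ok_bounded[OF okS] ..
    have holS: "S holomorphic_on \<Omega>" using okS by (simp add: ok_def)
    \<comment> \<open>The threshold yields \<open>real n + B \<le> \<delta> ^ n / 2 * D\<close>:
      half of the new increment \<open>\<delta> ^ n * D\<close> absorbs the old oscillation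
      \<open>B\<close> and provides \<open>n\<close>, and the other half is the surplus.\<close>
    have "ennreal (2 * (real n + B) / \<delta> ^ n) < (SUP (p, q) \<in> \<Omega> \<times> \<Omega>. interior_path_metric \<Omega> p q)"
      unfolding infinite by simp
    then obtain p q where pq: "p \<in> \<Omega>" "q \<in> \<Omega>"
      "ennreal (2 * (real n + B) / \<delta> ^ n) < interior_path_metric \<Omega> p q"
      by (auto simp: less_SUP_iff)
    obtain f where f: "f holomorphic_on \<Omega>" "\<forall>z\<in>\<Omega>. cmod (deriv f z) \<le> M"
      "interior_path_metric \<Omega> p q \<le> ennreal (dist (f p) (f q))"
      using test[OF pq(1,2)] by blast
    define D where "D = dist (f p) (f q)"
    have "ennreal (2 * (real n + B) / \<delta> ^ n) < ennreal D"
      using pq(3) f(3) unfolding D_def by (rule less_le_trans)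
    then have "2 * (real n + B) / \<delta> ^ n \<le> D"
      by (rule contrapos_pp) (simp add: not_less ennreal_leI)
    then have D: "real n + B \<le> \<delta> ^ n / 2 * D"
      using \<delta> by (simp add: field_simps)
    define S' where "S' = (\<lambda>z. S z + of_real (\<delta> ^ n) * f z)"
    have deriv': "deriv S' z = deriv S z + of_real (\<delta> ^ n) * deriv f z" if "z \<in> \<Omega>" for z
      unfolding S'_def
      using holomorphic_derivI[OF holS \<Omega>(1) that] holomorphic_derivI[OF f(1) \<Omega>(1) that]
      by (intro DERIV_imp_deriv) (auto intro!: derivative_eq_intros)
    have small: "cmod (deriv S' z - deriv S z) \<le> M * \<delta> ^ n" if "z \<in> \<Omega>" for z
      using f(2) that \<delta> by (simp add: deriv' norm_mult norm_power mult.commute[of M] mult_left_mono)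
    have "ok S'"
    proof -
      obtain A where A: "\<And>z. z \<in> \<Omega> \<Longrightarrow> cmod (deriv S z) \<le> A"
        using okS by (auto simp: ok_def bounded_iff)
      have "cmod (deriv S' z) \<le> A + M * \<delta> ^ n" if "z \<in> \<Omega>" for z
        using A[OF that] small[OF that] norm_triangle_sub[of "deriv S' z" "deriv S z"] by linarith
      moreover have "S' holomorphic_on \<Omega>"
        unfolding S'_def by (intro holomorphic_intros holS f(1))
      ultimately show ?thesis by (auto simp: ok_def bounded_iff)
    qed
    moreover have "real n + \<delta> ^ n / 2 * D \<le> dist (S' p) (S' q)"
    proof -
      have "of_real (\<delta> ^ n) * (f p - f q) = (S' p - S' q) - (S p - S q)"
        by (simp add: S'_def algebra_simps)
      then have "\<delta> ^ n * D \<le> dist (S' p) (S' q) + dist (S p) (S q)"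
        using norm_triangle_ineq4[of "S' p - S' q" "S p - S q"] \<delta>
        by (metis D_def abs_of_pos dist_norm norm_mult norm_of_real zero_less_power)
      then show ?thesis using D B pq(1,2) by force
    qed
    ultimately show ?thesis
      using small pq(1,2) f(3) zero_le_dist unfolding step_def D_def by blast
  qed
  moreover have "ok (\<lambda>_. 0)" by (simp add: ok_def image_constant_conv)
  ultimately obtain S where S: "\<And>n. ok (S n)" and step: "\<And>n. step n (S n) (S (Suc n))"
    using dependent_nat_choice[of "\<lambda>_. ok" step] by metis
  \<comment> \<open>The limit is taken for derivatives, where the M-test gives uniform convergence
    on all of \<open>\<Omega>\<close>; \<open>F\<close> is then a primitive of the limit.\<close>
  define d where "d = (\<lambda>n z. deriv (S (Suc n)) z - deriv (S n) z)"
  have d: "cmod (d n z) \<le> M * \<delta> ^ n" if "z \<in> \<Omega>" for n z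
    using step[of n] that by (simp add: step_def d_def)
  have geo: "summable (\<lambda>n. M * \<delta> ^ n)"
    using \<delta> by (intro summable_mult summable_geometric) simp
  have dsum: "summable (\<lambda>n. d n z)" if "z \<in> \<Omega>" for z
    using d[OF that] by (intro summable_comparison_test'[OF geo]) simp
  have telescope: "(\<Sum>i<n. d i z) = deriv (S n) z - deriv (S 0) z" for n z
    unfolding d_def using sum_lessThan_telescope[of "\<lambda>i. deriv (S i) z" n] by simp
  have ul: "uniform_limit \<Omega> (\<lambda>n z. \<Sum>i<n. d i z) (\<lambda>z. \<Sum>i. d i z) sequentially"
    using d geo by (rule Weierstrass_m_test)
  have holS': "deriv (S n) holomorphic_on \<Omega>" for n
    using S[of n] \<Omega>(1) unfolding ok_def by (blast intro: holomorphic_deriv)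
  have "(\<lambda>z. \<Sum>i. d i z) holomorphic_on \<Omega>"
  proof (rule holomorphic_uniform_sequence[OF \<Omega>(1)])
    show "(\<lambda>z. \<Sum>i<n. d i z) holomorphic_on \<Omega>" for n
      unfolding telescope by (intro holomorphic_intros holS')
    show "\<exists>r>0. cball x r \<subseteq> \<Omega> \<and> uniform_limit (cball x r) (\<lambda>n z. \<Sum>i<n. d i z) (\<lambda>z. \<Sum>i. d i z) sequentially"
      if x: "x \<in> \<Omega>" for x
    proof -
      obtain r where "r > 0" "cball x r \<subseteq> \<Omega>"
        using \<Omega>(1) x by (meson open_contains_cball)
      then show ?thesis using uniform_limit_on_subset[OF ul] by blast
    qed
  qed
  then have "(\<lambda>z. deriv (S 0) z + (\<Sum>i. d i z)) holomorphic_on \<Omega>"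
    by (intro holomorphic_intros holS')
  then obtain F where F: "\<And>z. z \<in> \<Omega> \<Longrightarrow> (F has_field_derivative deriv (S 0) z + (\<Sum>i. d i z)) (at z)"
    using iffD1[OF simply_connected_eq_global_primitive[OF \<Omega>(1)] \<Omega>(2)] by blast
  have holF: "F holomorphic_on \<Omega>"
    using F \<Omega>(1) by (meson holomorphic_on_open)
  \<comment> \<open>\<open>S (Suc n)\<close> already contains the term of step \<open>n\<close>, so
    the remainder starts at exponent \<open>Suc n\<close>; this supplies the factor
    \<open>\<delta>\<close> in the numerator of \<open>\<delta> / (1 - \<delta>)\<close>.\<close>
  have tail: "cmod (deriv F z - deriv (S (Suc n)) z) \<le> \<delta> ^ n / 2" if "z \<in> \<Omega>" for n z
  proof -
    have "deriv F z - deriv (S (Suc n)) z = (\<Sum>i. d i z) - (\<Sum>i<Suc n. d i z)"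
      unfolding telescope DERIV_imp_deriv[OF F[OF that]] by simp
    also have "\<dots> = (\<Sum>i. d (i + Suc n) z)"
      using suminf_split_initial_segment[OF dsum[OF that], of "Suc n"] by simp
    finally have eq: "deriv F z - deriv (S (Suc n)) z = (\<Sum>i. d (i + Suc n) z)" .
    have geo': "(\<lambda>i. M * \<delta> ^ (i + Suc n)) sums (M * \<delta> ^ Suc n * (1 / (1 - \<delta>)))"
      using sums_mult[OF geometric_sums[of \<delta>], of "M * \<delta> ^ Suc n"] \<delta> by (simp add: power_add mult_ac)
    have "cmod (\<Sum>i. d (i + Suc n) z) \<le> (\<Sum>i. M * \<delta> ^ (i + Suc n))"
      by (intro norm_suminf_le d that sums_summable[OF geo'])
    also have "\<dots> = \<delta> ^ n * (M * (\<delta> / (1 - \<delta>)))"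
      unfolding sums_unique[OF geo', symmetric] by (simp add: mult_ac)
    also have "\<delta> / (1 - \<delta>) = 1 / (2 * M)"
      using M by (simp add: \<delta>_def field_simps)
    finally show ?thesis using M eq by simp
  qed
  have "ok F"
  proof -
    obtain A where A: "\<And>z. z \<in> \<Omega> \<Longrightarrow> cmod (deriv (S 1) z) \<le> A"
      using S[of 1] by (auto simp: ok_def bounded_iff)
    have "cmod (deriv F z) \<le> A + 1 / 2" if "z \<in> \<Omega>" for z
      using A[OF that] tail[OF that, of 0] norm_triangle_sub[of "deriv F z" "deriv (S 1) z"] by simp
    then show ?thesis using holF by (auto simp: ok_def bounded_iff)
  qed
  then obtain B where B: "\<forall>p\<in>\<Omega>. \<forall>q\<in>\<Omega>. dist (F p) (F q) \<le> B" using ok_bounded by blast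
  obtain n where n: "B < real n" using reals_Archimedean2 by blast
  \<comment> \<open>The derivative bound on this remainder limits its increment from
    \<open>p\<close> to \<open>q\<close> to \<open>\<delta> ^ n / 2 * D\<close>, exactly the
    surplus. Hence \<open>F\<close> moves by at least \<open>n > B\<close> between these
    points.\<close>
  define R where "R = (\<lambda>z. F z - S (Suc n) z)"
  have holS: "S (Suc n) holomorphic_on \<Omega>" using S by (simp add: ok_def)
  obtain p q D where "D \<ge> 0" and pq: "p \<in> \<Omega>" "q \<in> \<Omega>" "interior_path_metric \<Omega> p q \<le> ennreal D"
    "real n + \<delta> ^ n / 2 * D \<le> dist (S (Suc n) p) (S (Suc n) q)"
    using step[of n] unfolding step_def by blast
  have "ennreal (dist (R p) (R q) / (\<delta> ^ n / 2)) \<le> interior_path_metric \<Omega> p q"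
  proof (rule dist_le_interior_path_metric_of_bounded_deriv[OF \<Omega>(1)])
    show "R holomorphic_on \<Omega>"
      unfolding R_def by (intro holomorphic_intros holF holS)
    show "cmod (deriv R z) \<le> \<delta> ^ n / 2" if "z \<in> \<Omega>" for z
    proof -
      have "deriv R z = deriv F z - deriv (S (Suc n)) z"
        unfolding R_def
        using holomorphic_derivI[OF holF \<Omega>(1) that] holomorphic_derivI[OF holS \<Omega>(1) that]
        by (intro DERIV_imp_deriv DERIV_diff)
      then show ?thesis using tail[OF that] by simp
    qed
  qed (use \<delta> in simp)
  then have le: "ennreal (dist (R p) (R q) / (\<delta> ^ n / 2)) \<le> ennreal D"
    using pq(3) by (rule order_trans)
  have "dist (R p) (R q) \<le> \<delta> ^ n / 2 * D"
    using le \<open>D \<ge> 0\<close> \<delta> by (simp add: field_simps)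
  moreover have "dist (S (Suc n) p) (S (Suc n) q) \<le> dist (F p) (F q) + dist (R p) (R q)"
    using norm_triangle_ineq4[of "F p - F q" "R p - R q"] by (simp add: R_def dist_norm algebra_simps)
  ultimately show False
    using B pq n by force
qed

section \<open>The two implications of the equivalence\<close>

theorem theorem1p1:
  fixes \<Omega> :: "complex set"
  assumes "domain \<Omega>" and "simply_connected \<Omega>"
  shows "(\<exists>f. f analytic_on \<Omega> \<and> \<not> bounded (f ` \<Omega>) \<and> bounded (deriv f ` \<Omega>)) \<longleftrightarrow>
         (SUP (p, q) \<in> \<Omega> \<times> \<Omega>. interior_path_metric \<Omega> p q) = \<infinity>"
proof
  have op: "open \<Omega>" using assms(1) by (simp add: domain_def)
  {
    assume "\<exists>f. f analytic_on \<Omega> \<and> \<not> bounded (f ` \<Omega>) \<and> bounded (deriv f ` \<Omega>)"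
    then obtain f where f: "f holomorphic_on \<Omega>" "\<not> bounded (f ` \<Omega>)" "bounded (deriv f ` \<Omega>)"
      using analytic_on_open[OF op] by blast
    obtain B where B: "0 < B" "\<And>z. z \<in> \<Omega> \<Longrightarrow> cmod (deriv f z) \<le> B"
      using f(3) by (auto simp: bounded_pos)
    show "(SUP (p, q) \<in> \<Omega> \<times> \<Omega>. interior_path_metric \<Omega> p q) = \<infinity>"
    proof (rule ccontr)
      assume "(SUP (p, q) \<in> \<Omega> \<times> \<Omega>. interior_path_metric \<Omega> p q) \<noteq> \<infinity>"
      then obtain K where K: "K \<ge> 0" "(SUP (p, q) \<in> \<Omega> \<times> \<Omega>. interior_path_metric \<Omega> p q) = ennreal K"
        by (metis ennreal_cases infinity_ennreal_def)
      have "dist (f p) (f q) \<le> K * B" if "p \<in> \<Omega>" "q \<in> \<Omega>" for p q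
      proof -
        have "ennreal (dist (f p) (f q) / B) \<le> interior_path_metric \<Omega> p q"
          using dist_le_interior_path_metric_of_bounded_deriv[OF op f(1) B(2,1)] .
        also have "\<dots> \<le> ennreal K"
          unfolding K(2)[symmetric] using that by (intro SUP_upper2[of "(p, q)"]) auto
        finally show ?thesis using K(1) B(1) by (simp add: field_simps)
      qed
      then show False using f(2) unfolding bounded_two_points by blast
    qed
  next
    assume infinite: "(SUP (p, q) \<in> \<Omega> \<times> \<Omega>. interior_path_metric \<Omega> p q) = \<infinity>"
    show "\<exists>f. f analytic_on \<Omega> \<and> \<not> bounded (f ` \<Omega>) \<and> bounded (deriv f ` \<Omega>)"
    proof (cases "\<Omega> = UNIV")
      \<comment> \<open>The plane is not conformally equivalent to the strip; here the identity is
        unbounded with derivative 1.\<close>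
      case True
      then show ?thesis
        by (intro exI[of _ "\<lambda>z. z"]) (simp add: analytic_on_ident image_constant_conv)
    next
      case False
      obtain M :: real where M: "M > 0" and
        test: "\<And>\<Omega> p q. open \<Omega> \<Longrightarrow> simply_connected \<Omega> \<Longrightarrow> \<Omega> \<noteq> UNIV \<Longrightarrow> p \<in> \<Omega> \<Longrightarrow> q \<in> \<Omega> \<Longrightarrow>
          \<exists>f. f holomorphic_on \<Omega> \<and> (\<forall>z\<in>\<Omega>. cmod (deriv f z) \<le> M) \<and>
            interior_path_metric \<Omega> p q \<le> ennreal (dist (f p) (f q))"
        by (rule test_functions_for_interior_path_metric) blast
      show ?thesis
        unfolding analytic_on_open[OF op]
        using op assms(2) M test[OF op assms(2) False] infinite
        by (rule unbounded_of_test_functions)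
    qed
  }
qed

end
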